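(* Let $A\in\mathbb{R}^{m\times n}$, let $\bar\lambda\ge\lambda>0$, and let $\mathcal{D}$ be a probability distribution over subsets of $[m]$. Suppose that the regularized projection matrix $P_{\lambda,S}:=A_S^\top(A_SA_S^\top+\lambda I)^{-1}A_S$ satisfies $$\bar P_\lambda:=\mathbb{E}_{S\sim\mathcal{D}}[P_{\lambda,S}]\succeq c\,A^\top A(A^\top A+\bar\lambda I)^{-1}$$ for some $c\in(0,1]$. Then $$\lambda_{\max}\Big(\mathbb{E}\big[(\bar P_\lambda^{\dagger/2}P_{\lambda,S}\bar P_\lambda^{\dagger/2})^2\big]\Big)\le\frac{2\bar\lambda}{c\lambda}.$$ If in addition $A_S^\top A_S\preceq\alpha A^\top A$ holds with probability $1-\delta$ for some $\alpha\in[0,1]$ and $\delta\in[0,\alpha/\|\bar P_\lambda^\dagger\|]$, then $$\lambda_{\max}\Big(\mathbb{E}\big[(\bar P_\lambda^{\dagger/2}P_{\lambda,S}\bar P_\lambda^{\dagger/2})^2\big]\Big)\le\frac2c\Big(1+\alpha\frac{\bar\lambda}{\lambda}\Big).$$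
   Context: $A_S$ is the submatrix of rows of $A$ indexed by $S$. $M^\dagger$ is the Moore-Penrose pseudoinverse and $M^{\dagger/2}=(M^\dagger)^{1/2}$ for positive semidefinite $M$; $\lambda_{\max}$ is the largest eigenvalue, $\|\cdot\|$ the spectral norm, and $\succeq,\preceq$ the positive semidefinite (Loewner) order. Expectations are over $S\sim\mathcal{D}$. *)

theory Defs
  imports "HOL-Probability.Probability"
begin

text \<open>The matrix \<open>A\<^sub>S\<close> has \<open>|S|\<close> rows, and \<open>S\<close> is random, so its size cannot be a type.
  A matrix with rows indexed by a set \<open>I\<close> and columns indexed by a set \<open>J\<close> is therefore represented
  by a function of two arguments of which only the values on \<open>I \<times> J\<close> are meaningful. The operations
  below take the relevant index set explicitly and never look outside of it.\<close>

type_synonym ('i, 'j) imat = "'i \<Rightarrow> 'j \<Rightarrow> real"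

definition row_submatrix :: "real^'n^'m \<Rightarrow> 'm set \<Rightarrow> ('m, 'n) imat" where
  "row_submatrix A S = (\<lambda>i j. if i \<in> S then A $ i $ j else undefined)"

definition imat_transpose :: "('i, 'j) imat \<Rightarrow> ('j, 'i) imat" where
  "imat_transpose M = (\<lambda>j i. M i j)"

definition imat_one :: "('i, 'i) imat" where
  "imat_one = (\<lambda>i j. if i = j then 1 else 0)"

definition imat_add :: "('i, 'j) imat \<Rightarrow> ('i, 'j) imat \<Rightarrow> ('i, 'j) imat" where
  "imat_add M N = (\<lambda>i j. M i j + N i j)"

definition imat_scale :: "real \<Rightarrow> ('i, 'j) imat \<Rightarrow> ('i, 'j) imat" where
  "imat_scale r M = (\<lambda>i j. r * M i j)"

text \<open>The first argument is the index set that is summed over.\<close>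

definition imat_mult :: "'k set \<Rightarrow> ('i, 'k) imat \<Rightarrow> ('k, 'j) imat \<Rightarrow> ('i, 'j) imat" where
  "imat_mult K M N = (\<lambda>i j. \<Sum>k\<in>K. M i k * N k j)"

text \<open>Counterpart of \<^const>\<open>matrix_inv\<close> for square matrices indexed by \<open>S \<times> S\<close>.\<close>

definition imat_inv :: "'i set \<Rightarrow> ('i, 'i) imat \<Rightarrow> ('i, 'i) imat" where
  "imat_inv S M = (SOME N. \<forall>i\<in>S. \<forall>j\<in>S.
     imat_mult S M N i j = imat_one i j \<and> imat_mult S N M i j = imat_one i j)"

definition mat_of_imat :: "('m::finite, 'n::finite) imat \<Rightarrow> real^'n^'m" where
  "mat_of_imat M = (\<chi> i j. M i j)"

text \<open>\<open>P\<^bsub>\<lambda>,S\<^esub> = A\<^sub>S\<^sup>T (A\<^sub>S A\<^sub>S\<^sup>T + \<lambda> I)\<^sup>-\<^sup>1 A\<^sub>S\<close>, with \<open>I\<close> and the inverse of size \<open>|S|\<close>.\<close>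

definition reg_proj :: "real^'n^'m \<Rightarrow> real \<Rightarrow> 'm set \<Rightarrow> real^'n^'n" where
  "reg_proj A l S =
     (let A_S = row_submatrix A S;
          K = imat_add (imat_mult UNIV A_S (imat_transpose A_S)) (imat_scale l imat_one)
      in mat_of_imat (imat_mult S (imat_mult S (imat_transpose A_S) (imat_inv S K)) A_S))"

definition sub_gram :: "real^'n^'m \<Rightarrow> 'm set \<Rightarrow> real^'n^'n" where
  "sub_gram A S =
     (let A_S = row_submatrix A S in mat_of_imat (imat_mult S (imat_transpose A_S) A_S))"

definition psd :: "real^'n^'n \<Rightarrow> bool" where
  "psd M \<longleftrightarrow> transpose M = M \<and> (\<forall>x. 0 \<le> x \<bullet> (M *v x))"

definition loewner_le :: "real^'n^'n \<Rightarrow> real^'n^'n \<Rightarrow> bool" (infix "\<preceq>" 50) where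
  "M \<preceq> N \<longleftrightarrow> psd (N - M)"

text \<open>The Moore-Penrose pseudoinverse, characterised by the four Penrose conditions.\<close>

definition pinv :: "real^'n^'m \<Rightarrow> real^'m^'n" where
  "pinv M = (THE X. M ** X ** M = M \<and> X ** M ** X = X \<and>
                    transpose (M ** X) = M ** X \<and> transpose (X ** M) = X ** M)"

text \<open>The positive semidefinite square root; meaningful for positive semidefinite \<open>M\<close> only.\<close>

definition psd_sqrt :: "real^'n^'n \<Rightarrow> real^'n^'n" where
  "psd_sqrt M = (THE R. psd R \<and> R ** R = M)"

definition is_eigenvalue :: "real^'n^'n \<Rightarrow> real \<Rightarrow> bool" where
  "is_eigenvalue M k \<longleftrightarrow> (\<exists>v. v \<noteq> 0 \<and> M *v v = k *\<^sub>R v)"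

definition lambda_max :: "real^'n^'n \<Rightarrow> real" where
  "lambda_max M = Max {k. is_eigenvalue M k}"

definition spectral_norm :: "real^'n^'m \<Rightarrow> real" where
  "spectral_norm M = onorm ((*v) M)"

definition mean_proj :: "real^'n^'m \<Rightarrow> real \<Rightarrow> 'm set pmf \<Rightarrow> real^'n^'n" where
  "mean_proj A l D = measure_pmf.expectation D (\<lambda>S. reg_proj A l S)"

text \<open>\<open>E[(Q P\<^bsub>\<lambda>,S\<^esub> Q)\<^sup>2]\<close>, where \<open>Q\<close> is the square root of the pseudoinverse of the mean of
  \<open>P\<^bsub>\<lambda>,S\<^esub>\<close>.\<close>

definition normalized_second_moment :: "real^'n^'m \<Rightarrow> real \<Rightarrow> 'm set pmf \<Rightarrow> real^'n^'n" where
  "normalized_second_moment A l D =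
     (let Q = psd_sqrt (pinv (mean_proj A l D))
      in measure_pmf.expectation D
           (\<lambda>S. (Q ** reg_proj A l S ** Q) ** (Q ** reg_proj A l S ** Q)))"

end

theory Submission
  imports Defs
begin

text \<open>Write \<open>H = A\<^sup>T A\<close>, \<open>H\<^sub>S = A\<^sub>S\<^sup>T A\<^sub>S\<close>, let \<open>P\<^sub>S = H\<^sub>S (H\<^sub>S + \<lambda> I)\<^sup>-\<^sup>1\<close> be the regularized projection of a sample,
  \<open>M\<close> the mean of the \<open>P\<^sub>S\<close>, and \<open>Q\<close> the square root of \<open>M\<^sup>\<dagger>\<close>. The matrix under study is
  \<open>Q E[P\<^sub>S M\<^sup>\<dagger> P\<^sub>S] Q\<close>. The assumption on \<open>M\<close> says in essence that \<open>M\<^sup>\<dagger> \<preceq> (1/c) (I + \<lambda>' H\<^sup>\<dagger>)\<close>, where \<open>\<lambda>'\<close> is the larger of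
  the two regularization parameters. If \<open>H\<^sub>S \<preceq> \<alpha> H\<close>, then \<open>P\<^sub>S H\<^sup>\<dagger> P\<^sub>S\<close> is at most
  \<open>\<alpha> H\<^sub>S (H\<^sub>S + \<lambda> I)\<^sup>-\<^sup>2\<close>, and together with \<open>P\<^sub>S\<^sup>2 = H\<^sub>S\<^sup>2 (H\<^sub>S + \<lambda> I)\<^sup>-\<^sup>2\<close> and
  \<open>P\<^sub>S = (H\<^sub>S\<^sup>2 + \<lambda> H\<^sub>S) (H\<^sub>S + \<lambda> I)\<^sup>-\<^sup>2\<close> this gives
  \<open>P\<^sub>S M\<^sup>\<dagger> P\<^sub>S \<preceq> (r/c) P\<^sub>S\<close> with \<open>r = max 1 (\<alpha> \<lambda>'/\<lambda>)\<close>. This is lemma \<open>pinv_form_reg_proj_le\<close>, proved there by a duality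
  argument that never mentions \<open>H\<^sup>\<dagger>\<close>.

  Averaging gives \<open>(r/c) Q M Q\<close>, and \<open>Q M Q\<close> is an orthogonal projection (lemma
  \<open>whitened_psd_le_identity\<close>). Since \<open>H\<^sub>S \<preceq> H\<close> always holds, the choice \<open>\<alpha> = 1\<close> yields the unconditional bound.
  In the second bound the exceptional samples, of probability at most \<open>\<delta>\<close>, obey the same estimate with
  \<open>\<alpha> = 1\<close>; as \<open>Q P\<^sub>S Q \<preceq> Q\<^sup>2 = M\<^sup>\<dagger>\<close>, they add at most \<open>\<lambda>'/(c \<lambda>)\<close> times \<open>\<delta>\<close> times the norm of \<open>M\<^sup>\<dagger>\<close>, hence at most
  \<open>\<alpha> \<lambda>'/(c \<lambda>)\<close>; lemma \<open>lambda_max_normalized_second_moment_le\<close> combines the two parts.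

  Pseudoinverse, square root and largest eigenvalue are given by descriptions and a maximum, so their
  defining properties require existence and uniqueness; all of this comes from an
  orthonormal eigenbasis (theorem \<open>symmetric_orthonormal_eigenbasis\<close>).\<close>

section \<open>The spectral theorem for real symmetric matrices\<close>

lemma inner_symmetric_matrix:
  fixes M :: "real^'n^'n"
  assumes "transpose M = M"
  shows "x \<bullet> (M *v y) = (M *v x) \<bullet> y"
  by (metis assms dot_lmul_matrix transpose_matrix_vector)

lemma symmetric_matrixI:
  fixes M :: "real^'n^'n"
  assumes "\<And>x y. x \<bullet> (M *v y) = (M *v x) \<bullet> y"
  shows "transpose M = M"
proof -
  have "(transpose M *v x) \<bullet> y = (M *v x) \<bullet> y" for x y
    using assms[of x y] by (metis dot_lmul_matrix transpose_matrix_vector)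
  then have "transpose M *v x = M *v x" for x
    by (metis vector_eq_rdot)
  then show ?thesis by (simp add: matrix_eq)
qed

text \<open>A maximiser of the quadratic form on the unit sphere of an invariant subspace is an eigenvector:
  the residual \<open>y = M v - k v\<close> lies in the subspace and is an ascent direction unless it vanishes.\<close>

lemma rayleigh_maximizer_eigenvector:
  fixes M :: "real^'n^'n"
  assumes sym: "transpose M = M" and V: "subspace V" "V \<noteq> {0}"
    and inv: "\<And>x. x \<in> V \<Longrightarrow> M *v x \<in> V"
  obtains v k where "v \<in> V" "norm v = 1" "M *v v = k *\<^sub>R v"
proof -
  let ?f = "\<lambda>x. x \<bullet> (M *v x)"
  obtain u where u: "u \<in> V" "u \<noteq> 0" using V subspace_0 by blast
  have ne: "sphere 0 1 \<inter> V \<noteq> {}"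
  proof -
    have "u /\<^sub>R norm u \<in> sphere 0 1 \<inter> V" using u V(1) by (simp add: subspace_scale)
    then show ?thesis by blast
  qed
  have "compact (sphere 0 1 \<inter> V)"
    by (simp add: closed_subspace V(1) compact_Int_closed)
  moreover have "continuous_on (sphere 0 1 \<inter> V) ?f"
    by (intro continuous_intros)
  ultimately obtain v where v: "v \<in> sphere 0 1 \<inter> V"
    and max: "\<And>x. x \<in> sphere 0 1 \<inter> V \<Longrightarrow> ?f x \<le> ?f v"
    using continuous_attains_sup ne by meson
  have v1: "v \<bullet> v = 1" using v by (simp add: dot_square_norm)
  define k where "k = ?f v"
  have bound: "?f x \<le> k * (x \<bullet> x)" if "x \<in> V" for x
  proof (cases "x = 0")
    case False
    have "x /\<^sub>R norm x \<in> sphere 0 1 \<inter> V" using that V(1) False by (simp add: subspace_scale)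
    from max[OF this] have "?f x / (norm x)\<^sup>2 \<le> k"
      by (simp add: k_def matrix_vector_mult_scaleR power2_eq_square divide_inverse mult_ac)
    then show ?thesis using False by (simp add: divide_le_eq dot_square_norm)
  qed simp
  define y where "y = M *v v - k *\<^sub>R v"
  have yV: "y \<in> V" unfolding y_def using V(1) inv v by (simp add: subspace_diff subspace_scale)
  have yy: "y \<bullet> (M *v v) - k * (y \<bullet> v) = y \<bullet> y"
    by (simp add: y_def inner_diff_left inner_diff_right)
  \<comment> \<open>The quadratic form at \<open>v + t y\<close> would exceed the maximum for a small \<open>t > 0\<close>.\<close>
  have key: "2 * t * (y \<bullet> y) + t\<^sup>2 * (?f y - k * (y \<bullet> y)) \<le> 0" for t
  proof -
    have "v + t *\<^sub>R y \<in> V" using v yV V(1) by (simp add: subspace_add subspace_scale)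
    note bound[OF this]
    also have "(v + t *\<^sub>R y) \<bullet> (v + t *\<^sub>R y) = 1 + 2 * t * (y \<bullet> v) + t\<^sup>2 * (y \<bullet> y)"
      using v1 by (simp add: inner_simps power2_eq_square inner_commute algebra_simps)
    also have "?f (v + t *\<^sub>R y) = k + 2 * t * (y \<bullet> (M *v v)) + t\<^sup>2 * ?f y"
      using inner_symmetric_matrix[OF sym, of v y]
      by (simp add: matrix_vector_right_distrib matrix_vector_mult_scaleR inner_simps k_def
          power2_eq_square inner_commute algebra_simps)
    also have "y \<bullet> (M *v v) = y \<bullet> y + k * (y \<bullet> v)" using yy by simp
    finally show ?thesis by (simp add: distrib_left right_diff_distrib mult.left_commute mult.assoc)
  qed
  have "y \<bullet> y = 0"
  proof (rule ccontr)
    assume "y \<bullet> y \<noteq> 0"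
    then have pos: "0 < y \<bullet> y" by (simp add: order_less_le)
    \<comment> \<open>Small enough for the linear term in \<open>t\<close> to outweigh the quadratic one.\<close>
    define b where "b = \<bar>?f y - k * (y \<bullet> y)\<bar>"
    define t where "t = (y \<bullet> y) / (b + 1)"
    have t: "t > 0" "t * b < y \<bullet> y + y \<bullet> y" using pos by (auto simp: t_def b_def field_simps add_pos_nonneg)
    have "t * (2 * (y \<bullet> y) + t * (?f y - k * (y \<bullet> y))) \<le> 0"
      using key[of t] by (simp add: algebra_simps power2_eq_square)
    then have "2 * (y \<bullet> y) + t * (?f y - k * (y \<bullet> y)) \<le> 0"
      using t(1) by (simp add: mult_le_0_iff)
    moreover have "t * (?f y - k * (y \<bullet> y)) \<ge> - (t * b)"
      using t(1) mult_left_mono[of "-b" "?f y - k * (y \<bullet> y)" t] by (simp add: b_def)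
    ultimately show False using t(2) by linarith
  qed
  then have "M *v v = k *\<^sub>R v" by (simp add: y_def)
  with v that show thesis by auto
qed

definition orthonormal_eigenbasis :: "real^'n^'n \<Rightarrow> (real^'n) set \<Rightarrow> (real^'n \<Rightarrow> real) \<Rightarrow> bool" where
  "orthonormal_eigenbasis M B k \<longleftrightarrow> finite B \<and> span B = UNIV \<and>
     (\<forall>b\<in>B. \<forall>b'\<in>B. b \<bullet> b' = (if b = b' then 1 else 0)) \<and> (\<forall>b\<in>B. M *v b = k b *\<^sub>R b)"

text \<open>Split off one eigenvector; by symmetry its orthogonal complement inside \<open>V\<close> is again invariant,
  and its dimension is smaller.\<close>

lemma invariant_subspace_orthonormal_eigenvectors:
  fixes M :: "real^'n^'n"
  assumes sym: "transpose M = M"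
  shows "subspace V \<Longrightarrow> (\<And>x. x \<in> V \<Longrightarrow> M *v x \<in> V) \<Longrightarrow>
    \<exists>B. finite B \<and> B \<subseteq> V \<and> V \<subseteq> span B \<and> (\<forall>b\<in>B. \<forall>b'\<in>B. b \<bullet> b' = (if b = b' then 1 else 0)) \<and>
      (\<forall>b\<in>B. \<exists>k. M *v b = k *\<^sub>R b)"
proof (induction "dim V" arbitrary: V rule: less_induct)
  case less
  show ?case
  proof (cases "V = {0}")
    case True
    then show ?thesis by (intro exI[of _ "{}"]) auto
  next
    case False
    obtain v k where v: "v \<in> V" "norm v = 1" "M *v v = k *\<^sub>R v"
      using rayleigh_maximizer_eigenvector[OF sym less.prems(1) False less.prems(2)] by blast
    have vv: "v \<bullet> v = 1" using v by (simp add: dot_square_norm)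
    define W where "W = {x \<in> V. v \<bullet> x = 0}"
    have W: "subspace W"
      using less.prems(1) by (auto simp: W_def subspace_def inner_simps)
    have "v \<notin> W" using vv by (simp add: W_def)
    moreover have "W \<subseteq> V" by (auto simp: W_def)
    ultimately have "W \<subset> V" using v(1) by blast
    then have "dim W < dim V"
      by (simp add: dim_psubset W less.prems(1) span_eq_iff[THEN iffD2])
    moreover have "M *v x \<in> W" if "x \<in> W" for x
      using that less.prems(2) inner_symmetric_matrix[OF sym, of v x] v(3) by (simp add: W_def)
    ultimately obtain B where B: "finite B" "B \<subseteq> W" "W \<subseteq> span B"
        "\<forall>b\<in>B. \<forall>b'\<in>B. b \<bullet> b' = (if b = b' then 1 else 0)" "\<forall>b\<in>B. \<exists>k. M *v b = k *\<^sub>R b"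
      using less.hyps[OF _ W] by metis
    have vB: "v \<bullet> b = 0" "b \<bullet> v = 0" if "b \<in> B" for b
      using that B(2) by (auto simp: W_def inner_commute)
    have "V \<subseteq> span (insert v B)"
    proof
      fix x assume "x \<in> V"
      then have "x - (v \<bullet> x) *\<^sub>R v \<in> W"
        using v vv less.prems(1) by (simp add: W_def subspace_diff subspace_scale inner_simps)
      then show "x \<in> span (insert v B)" using B(3) by (auto simp: span_insert)
    qed
    moreover have "insert v B \<subseteq> V" using B(2) v(1) by (auto simp: W_def)
    moreover have "v \<notin> B" using vB vv by force
    ultimately show ?thesis using B v vB vv
      by (intro exI[of _ "insert v B"]) auto
  qed
qed

theorem symmetric_orthonormal_eigenbasis:
  fixes M :: "real^'n^'n"
  assumes "transpose M = M"
  obtains B k where "orthonormal_eigenbasis M B k"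
proof -
  obtain B where B: "finite B" "UNIV \<subseteq> span B"
      "\<forall>b\<in>B. \<forall>b'\<in>B. b \<bullet> b' = (if b = b' then 1 else 0)" "\<forall>b\<in>B. \<exists>k. M *v b = k *\<^sub>R b"
    using invariant_subspace_orthonormal_eigenvectors[OF assms, of UNIV] by auto
  from B(4) obtain k where "\<forall>b\<in>B. M *v b = k b *\<^sub>R b" by metis
  with B that[of B k] show thesis unfolding orthonormal_eigenbasis_def by blast
qed

lemma matrix_eq_on_spanning_set:
  fixes M N :: "real^'n^'m"
  assumes "span B = UNIV" "\<And>b. b \<in> B \<Longrightarrow> M *v b = N *v b"
  shows "M = N"
proof -
  have "M *v x = N *v x" for x
    using linear_eq_on_span[of "(*v) M" "(*v) N" B x] assms by auto
  then show ?thesis by (simp add: matrix_eq)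
qed

lemma vector_eq_inner_spanning_set:
  fixes x y :: "real^'n"
  assumes "span B = UNIV" "\<And>b. b \<in> B \<Longrightarrow> x \<bullet> b = y \<bullet> b"
  shows "x = y"
proof -
  have "x \<bullet> z = y \<bullet> z" for z
    using linear_eq_on_span[of "(\<bullet>) x" "(\<bullet>) y" B z] assms
    by (auto simp: bounded_linear.linear bounded_linear_inner_right)
  then show ?thesis by (metis vector_eq_rdot)
qed

text \<open>The matrix \<open>\<Sum> f(b) b b\<^sup>T\<close>. For an orthonormal eigenbasis \<open>B\<close> of \<open>M\<close> with eigenvalues \<open>k\<close> and
  \<open>f = g \<circ> k\<close> this is \<open>g(M)\<close> in the functional calculus.\<close>

definition diagonal_in :: "(real^'n) set \<Rightarrow> (real^'n \<Rightarrow> real) \<Rightarrow> real^'n^'n" where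
  "diagonal_in B f = (\<chi> i j. \<Sum>b\<in>B. f b * b $ i * b $ j)"

lemma diagonal_in_mult_vec: "diagonal_in B f *v x = (\<Sum>b\<in>B. (f b * (b \<bullet> x)) *\<^sub>R b)"
proof -
  have "(\<Sum>j\<in>UNIV. (\<Sum>b\<in>B. f b * b $ i * b $ j) * x $ j) = (\<Sum>b\<in>B. f b * (b \<bullet> x) * b $ i)" for i
    unfolding sum_distrib_right inner_vec_def sum_distrib_left
    by (subst sum.swap) (simp add: mult_ac)
  then show ?thesis
    by (simp add: vec_eq_iff diagonal_in_def matrix_vector_mult_def sum_component)
qed

lemma transpose_diagonal_in [simp]: "transpose (diagonal_in B f) = diagonal_in B f"
  by (simp add: transpose_def diagonal_in_def vec_eq_iff mult_ac)

lemma diagonal_in_eigenvector: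
  assumes "orthonormal_eigenbasis M B k" "b \<in> B"
  shows "diagonal_in B f *v b = f b *\<^sub>R b"
proof -
  have "diagonal_in B f *v b = (\<Sum>b'\<in>B. if b' = b then f b *\<^sub>R b else 0)"
    unfolding diagonal_in_mult_vec using assms
    by (intro sum.cong) (auto simp: orthonormal_eigenbasis_def)
  then show ?thesis using assms by (simp add: orthonormal_eigenbasis_def)
qed

lemma psd_diagonal_in:
  assumes "\<And>b. b \<in> B \<Longrightarrow> 0 \<le> f b"
  shows "psd (diagonal_in B f)"
proof -
  have "x \<bullet> (diagonal_in B f *v x) = (\<Sum>b\<in>B. f b * (b \<bullet> x)\<^sup>2)" for x
    by (simp add: diagonal_in_mult_vec inner_sum_right inner_commute power2_eq_square mult_ac)
  then show ?thesis by (simp add: psd_def sum_nonneg assms)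
qed

section \<open>Square root, pseudoinverse and largest eigenvalue\<close>

lemma psd_eigenvalue_nonneg:
  assumes "psd M" "orthonormal_eigenbasis M B k" "b \<in> B"
  shows "0 \<le> k b"
proof -
  have "0 \<le> b \<bullet> (M *v b)" using assms(1) by (simp add: psd_def)
  with assms(2,3) show ?thesis by (simp add: orthonormal_eigenbasis_def)
qed

text \<open>For eigenvectors \<open>b\<close> of \<open>R\<close> and \<open>c\<close> of \<open>T\<close>, the common square forces the two eigenvalues to have
  equal squares unless \<open>b \<bottom> c\<close>. Nonnegative eigenvalues are then equal, so \<open>R\<close> and \<open>T\<close> have the same
  matrix entries between the two bases.\<close>

lemma psd_sqrt_unique:
  fixes R T :: "real^'n^'n"
  assumes R: "psd R" and T: "psd T" and eq: "R ** R = T ** T"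
  shows "R = T"
proof -
  have symR: "transpose R = R" and symT: "transpose T = T" using R T by (auto simp: psd_def)
  obtain B k where B: "orthonormal_eigenbasis R B k"
    using symmetric_orthonormal_eigenbasis[OF symR] .
  obtain C h where C: "orthonormal_eigenbasis T C h"
    using symmetric_orthonormal_eigenbasis[OF symT] .
  show ?thesis
  proof (rule matrix_eq_on_spanning_set)
    show "span B = UNIV" using B by (simp add: orthonormal_eigenbasis_def)
    fix b assume b: "b \<in> B"
    show "R *v b = T *v b"
    proof (rule vector_eq_inner_spanning_set)
      show "span C = UNIV" using C by (simp add: orthonormal_eigenbasis_def)
      fix c assume c: "c \<in> C"
      have Rb: "R *v b = k b *\<^sub>R b" and Tc: "T *v c = h c *\<^sub>R c"
        using B C b c by (auto simp: orthonormal_eigenbasis_def)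
      have "(R *v (R *v b)) \<bullet> c = (T *v (T *v b)) \<bullet> c"
        using eq by (simp add: matrix_vector_mul_assoc)
      also have "\<dots> = b \<bullet> (T *v (T *v c))"
        using inner_symmetric_matrix[OF symT] by simp
      finally have "((k b)\<^sup>2 - (h c)\<^sup>2) * (b \<bullet> c) = 0"
        by (simp add: Rb Tc matrix_vector_mult_scaleR power2_eq_square algebra_simps)
      moreover have "0 \<le> k b" "0 \<le> h c"
        using psd_eigenvalue_nonneg R T B C b c by blast+
      ultimately have "k b * (b \<bullet> c) = h c * (b \<bullet> c)" by auto
      then show "(R *v b) \<bullet> c = (T *v b) \<bullet> c"
        by (simp add: Rb Tc inner_symmetric_matrix[OF symT, symmetric])
    qed
  qed
qed

lemma psd_sqrt_props:
  fixes M :: "real^'n^'n"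
  assumes M: "psd M"
  shows "psd (psd_sqrt M)" "psd_sqrt M ** psd_sqrt M = M"
proof -
  obtain B k where B: "orthonormal_eigenbasis M B k"
    using symmetric_orthonormal_eigenbasis M by (metis psd_def)
  define R where "R = diagonal_in B (\<lambda>b. sqrt (k b))"
  have nn: "0 \<le> k b" if "b \<in> B" for b using psd_eigenvalue_nonneg[OF M B that] .
  have "psd R" unfolding R_def by (rule psd_diagonal_in) (simp add: nn)
  moreover have "R ** R = M"
  proof (rule matrix_eq_on_spanning_set)
    show "span B = UNIV" using B by (simp add: orthonormal_eigenbasis_def)
    fix b assume b: "b \<in> B"
    then have "M *v b = k b *\<^sub>R b" using B by (simp add: orthonormal_eigenbasis_def)
    then show "(R ** R) *v b = M *v b"
      using nn[OF b] diagonal_in_eigenvector[OF B b]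
      by (simp add: R_def matrix_vector_mult_scaleR flip: matrix_vector_mul_assoc)
  qed
  ultimately have "\<exists>!R. psd R \<and> R ** R = M" using psd_sqrt_unique by metis
  from theI'[OF this] show "psd (psd_sqrt M)" "psd_sqrt M ** psd_sqrt M = M"
    unfolding psd_sqrt_def by auto
qed

abbreviation is_pinv :: "real^'n^'m \<Rightarrow> real^'m^'n \<Rightarrow> bool" where
  "is_pinv M X \<equiv> M ** X ** M = M \<and> X ** M ** X = X \<and>
     transpose (M ** X) = M ** X \<and> transpose (X ** M) = X ** M"

text \<open>The products are determined: \<open>M X = (M Y) (M X)\<close>, and since both factors and the product are
  symmetric, also \<open>M X = (M X) (M Y) = M Y\<close>. Likewise \<open>X M = Y M\<close>, and then
  \<open>X = X M X = Y M Y = Y\<close>.\<close>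

lemma penrose_unique:
  assumes X: "is_pinv M X" and Y: "is_pinv M Y"
  shows "X = Y"
proof -
  have "M ** X = transpose ((M ** Y) ** (M ** X))"
    using X Y by (metis matrix_mul_assoc)
  also have "\<dots> = (M ** X) ** (M ** Y)"
    using X Y by (simp add: matrix_transpose_mul)
  also have "\<dots> = M ** Y" using X by (simp add: matrix_mul_assoc)
  finally have MX: "M ** X = M ** Y" .
  have "X ** M = transpose ((X ** M) ** (Y ** M))"
    using X Y by (metis matrix_mul_assoc)
  also have "\<dots> = (Y ** M) ** (X ** M)"
    using X Y by (simp add: matrix_transpose_mul)
  also have "\<dots> = Y ** M" using X by (metis matrix_mul_assoc)
  finally have XM: "X ** M = Y ** M" .
  show ?thesis using X Y MX XM by (metis matrix_mul_assoc)
qed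

lemma psd_pinv:
  fixes M :: "real^'n^'n"
  assumes M: "psd M"
  shows "is_pinv M (pinv M)" "psd (pinv M)"
proof -
  obtain B k where B: "orthonormal_eigenbasis M B k"
    using symmetric_orthonormal_eigenbasis M by (metis psd_def)
  \<comment> \<open>In a field \<open>inverse 0 = 0\<close>, so the kernel needs no separate treatment.\<close>
  define X where "X = diagonal_in B (\<lambda>b. inverse (k b))"
  \<comment> \<open>The orthogonal projection onto the range of \<open>M\<close>, the common value of \<open>M X\<close> and \<open>X M\<close>.\<close>
  define E where "E = diagonal_in B (\<lambda>b. if k b = 0 then 0 else 1)"
  have sp: "span B = UNIV" using B by (simp add: orthonormal_eigenbasis_def)
  have Mb: "M *v b = k b *\<^sub>R b" if "b \<in> B" for b
    using B that by (simp add: orthonormal_eigenbasis_def)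
  note simps = X_def E_def Mb diagonal_in_eigenvector[OF B] matrix_vector_mult_scaleR
  have "M ** X = E" "X ** M = E" "E ** M = M" "E ** X = X"
    by (rule matrix_eq_on_spanning_set[OF sp], simp add: simps flip: matrix_vector_mul_assoc)+
  then have X: "is_pinv M X" by (simp add: E_def)
  then have "pinv M = X" unfolding pinv_def using penrose_unique by (intro the_equality) blast+
  moreover have "psd X" unfolding X_def
    by (rule psd_diagonal_in) (simp add: psd_eigenvalue_nonneg[OF M B])
  ultimately show "is_pinv M (pinv M)" "psd (pinv M)" using X by auto
qed

text \<open>A maximum over a set that is empty or infinite is unspecified. The eigenbasis shows that
  the eigenvalues are exactly the finitely many values \<open>k b\<close>, of which there is at least one.\<close>

lemma lambda_max_le:
  fixes M :: "real^'n^'n"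
  assumes sym: "transpose M = M" and le: "\<And>x. x \<bullet> (M *v x) \<le> r * (x \<bullet> x)"
  shows "lambda_max M \<le> r"
proof -
  obtain B k where B: "orthonormal_eigenbasis M B k"
    using symmetric_orthonormal_eigenbasis[OF sym] .
  have sp: "span B = UNIV" and "finite B" and
    Mb: "\<And>b. b \<in> B \<Longrightarrow> M *v b = k b *\<^sub>R b"
    using B by (auto simp: orthonormal_eigenbasis_def)
  have b1: "b \<noteq> 0" if "b \<in> B" for b
    using B that unfolding orthonormal_eigenbasis_def by (metis inner_zero_left zero_neq_one)
  have "{h. is_eigenvalue M h} = k ` B"
  proof (intro equalityI subsetI)
    fix h assume "h \<in> {h. is_eigenvalue M h}"
    then obtain v where v: "v \<noteq> 0" "M *v v = h *\<^sub>R v" by (auto simp: is_eigenvalue_def)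
    then obtain b where b: "b \<in> B" "v \<bullet> b \<noteq> 0"
      using vector_eq_inner_spanning_set[OF sp, of v 0] by auto
    have "k b * (v \<bullet> b) = h * (v \<bullet> b)"
      using inner_symmetric_matrix[OF sym, of v b] unfolding v(2) Mb[OF b(1)] by simp
    then have "h = k b" using b(2) by simp
    then show "h \<in> k ` B" using b(1) by blast
  qed (use Mb b1 in \<open>auto simp: is_eigenvalue_def\<close>)
  moreover have "B \<noteq> {}"
  proof
    assume "B = {}"
    with sp have "(axis undefined 1 :: real^'n) = 0" by auto
    then show False by (simp add: axis_eq_0_iff)
  qed
  moreover have "k b \<le> r" if "b \<in> B" for b
    using le[of b] Mb[OF that] B that by (simp add: orthonormal_eigenbasis_def)
  ultimately show ?thesis using \<open>finite B\<close> by (simp add: lambda_max_def)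
qed

section \<open>The regularized projection as a resolvent\<close>

text \<open>Setting the rows outside \<open>S\<close> to zero keeps the Gram matrix \<open>A\<^sub>S\<^sup>T A\<^sub>S\<close> and the product \<open>A\<^sub>S x\<close> on \<open>S\<close>
  while making the row index set a type again.\<close>

definition mask_rows :: "real^'n^'m \<Rightarrow> 'm set \<Rightarrow> real^'n^'m" where
  "mask_rows A S = (\<chi> i j. if i \<in> S then A $ i $ j else 0)"

lemma mask_rows_mult_vec: "(mask_rows A S *v x) $ i = (if i \<in> S then (A *v x) $ i else 0)"
  by (simp add: mask_rows_def matrix_vector_mult_def)

lemma inner_gram:
  fixes A :: "real^'n^'m"
  shows "x \<bullet> ((transpose A ** A) *v y) = (A *v x) \<bullet> (A *v y)"
  by (metis dot_lmul_matrix matrix_vector_mul_assoc transpose_matrix_vector transpose_transpose)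

lemma psd_gram: "psd (transpose A ** A)" for A :: "real^'n^'m"
  by (simp add: psd_def matrix_transpose_mul inner_gram)

lemma sub_gram_eq: "sub_gram A S = transpose (mask_rows A S) ** mask_rows A S"
proof -
  have "(\<Sum>k\<in>S. A $ k $ i * A $ k $ j) =
      (\<Sum>k\<in>UNIV. (if k \<in> S then A $ k $ i else 0) * (if k \<in> S then A $ k $ j else 0))" for i j
    by (rule sum.mono_neutral_cong_left) auto
  then show ?thesis
    by (simp add: sub_gram_def mat_of_imat_def imat_mult_def imat_transpose_def row_submatrix_def
        mask_rows_def matrix_matrix_mult_def transpose_def vec_eq_iff cong: sum.cong)
qed

lemma sub_gram_le_gram:
  "x \<bullet> (sub_gram A S *v x) \<le> x \<bullet> ((transpose A ** A) *v x)"
proof -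
  have "(\<Sum>i\<in>UNIV. (mask_rows A S *v x) $ i * (mask_rows A S *v x) $ i)
      \<le> (\<Sum>i\<in>UNIV. (A *v x) $ i * (A *v x) $ i)"
    by (rule sum_mono) (simp add: mask_rows_mult_vec)
  then show ?thesis unfolding sub_gram_eq inner_gram by (simp add: inner_vec_def)
qed

lemma psd_plus_scaled_identity_inverse:
  fixes M :: "real^'n^'n"
  assumes "psd M" "0 < l"
  shows "(M + l *\<^sub>R mat 1) ** matrix_inv (M + l *\<^sub>R mat 1) = mat 1"
    and "matrix_inv (M + l *\<^sub>R mat 1) ** (M + l *\<^sub>R mat 1) = mat 1"
proof -
  let ?K = "M + l *\<^sub>R mat 1"
  have K: "?K *v x = M *v x + l *\<^sub>R x" for x
    by (simp add: matrix_vector_mult_add_rdistrib scaleR_matrix_vector_assoc[symmetric])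
  have "x = 0" if "?K *v x = 0" for x
  proof -
    have "0 = x \<bullet> (M *v x) + l * (x \<bullet> x)"
      using that K by (metis inner_add_right inner_scaleR_right inner_zero_right)
    moreover have "0 \<le> x \<bullet> (M *v x)" using assms(1) by (simp add: psd_def)
    ultimately have "l * (x \<bullet> x) \<le> 0" by linarith
    then have "x \<bullet> x \<le> 0" using assms(2) by (simp add: mult_le_0_iff)
    then show "x = 0" by (metis inner_eq_zero_iff inner_ge_zero order_antisym)
  qed
  then have "invertible ?K"
    using matrix_left_invertible_ker invertible_left_inverse by blast
  then have "?K ** matrix_inv ?K = mat 1 \<and> matrix_inv ?K ** ?K = mat 1"
    unfolding invertible_def matrix_inv_def by (rule someI_ex)
  then show "?K ** matrix_inv ?K = mat 1" "matrix_inv ?K ** ?K = mat 1" by auto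
qed

text \<open>With \<open>B\<close> the masked matrix, \<open>F = B B\<^sup>T + l I\<close> is block diagonal for the partition into \<open>S\<close> and its
  complement, and its block on \<open>S\<close> is \<open>K\<close>. As \<open>F\<close> is invertible, the block on \<open>S\<close> of its inverse is
  an inverse of \<open>K\<close>, hence the chosen inverse does satisfy its specification.\<close>

lemma regularized_imat_inv:
  fixes A :: "real^'n^'m"
  assumes l: "0 < l" and K: "K = imat_add (imat_mult UNIV (row_submatrix A S)
      (imat_transpose (row_submatrix A S))) (imat_scale l imat_one)"
    and i: "i \<in> S" and j: "j \<in> S"
  shows "imat_mult S K (imat_inv S K) i j = imat_one i j"
proof -
  let ?B = "mask_rows A S"
  define F where "F = ?B ** transpose ?B + l *\<^sub>R mat 1"
  define N where "N = matrix_inv F"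
  have "psd (?B ** transpose ?B)" using psd_gram[of "transpose ?B"] by simp
  from psd_plus_scaled_identity_inverse[OF this l]
  have FN: "F ** N = mat 1" "N ** F = mat 1" by (auto simp: F_def N_def)
  have FS: "F $ i $ j = K i j" if "i \<in> S" "j \<in> S" for i j
    using that by (simp add: F_def K imat_add_def imat_mult_def imat_transpose_def imat_scale_def
        imat_one_def row_submatrix_def mask_rows_def matrix_matrix_mult_def transpose_def mat_def)
  have F0: "F $ i $ j = 0" "F $ j $ i = 0" if "i \<in> S" "j \<notin> S" for i j
    using that by (auto simp: F_def mask_rows_def matrix_matrix_mult_def transpose_def mat_def)
  have "imat_mult S K (\<lambda>i j. N $ i $ j) i j = imat_one i j \<and>
      imat_mult S (\<lambda>i j. N $ i $ j) K i j = imat_one i j" if "i \<in> S" "j \<in> S" for i j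
  proof -
    have "imat_mult S K (\<lambda>i j. N $ i $ j) i j = (F ** N) $ i $ j"
      using that FS F0 unfolding imat_mult_def matrix_matrix_mult_def
      by (simp, intro sum.mono_neutral_cong_left) auto
    moreover have "imat_mult S (\<lambda>i j. N $ i $ j) K i j = (N ** F) $ i $ j"
      using that FS F0 unfolding imat_mult_def matrix_matrix_mult_def
      by (simp, intro sum.mono_neutral_cong_left) auto
    ultimately show ?thesis by (simp add: FN mat_def imat_one_def)
  qed
  then have "\<exists>N. \<forall>i\<in>S. \<forall>j\<in>S. imat_mult S K N i j = imat_one i j \<and> imat_mult S N K i j = imat_one i j"
    by blast
  from someI_ex[OF this] show ?thesis using i j unfolding imat_inv_def by blast
qed

text \<open>This is the push-through identity \<open>A\<^sub>S\<^sup>T (A\<^sub>S A\<^sub>S\<^sup>T + l I)\<^sup>-\<^sup>1 A\<^sub>S = H\<^sub>S (H\<^sub>S + l I)\<^sup>-\<^sup>1\<close> with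
  \<open>H\<^sub>S = A\<^sub>S\<^sup>T A\<^sub>S\<close>, applied to \<open>z\<close>; the vector \<open>v\<close> is \<open>(H\<^sub>S + l I)\<^sup>-\<^sup>1 z\<close>. If \<open>u = (A\<^sub>S A\<^sub>S\<^sup>T + l I)\<^sup>-\<^sup>1 A\<^sub>S z\<close>
  and \<open>y = A\<^sub>S\<^sup>T u\<close>, then \<open>A\<^sub>S y + l u = A\<^sub>S z\<close>, so \<open>u = A\<^sub>S v\<close> for \<open>v = (z - y) / l\<close>. All later facts about
  the regularized projection follow from this description.\<close>

lemma reg_proj_resolvent:
  fixes A :: "real^'n^'m"
  assumes l: "0 < l"
  obtains v where "reg_proj A l S *v z = sub_gram A S *v v" "z = sub_gram A S *v v + l *\<^sub>R v"
proof -
  let ?B = "mask_rows A S"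
  define K where "K = imat_add (imat_mult UNIV (row_submatrix A S)
      (imat_transpose (row_submatrix A S))) (imat_scale l imat_one)"
  define N where "N = imat_inv S K"
  define u :: "real^'m" where "u = (\<chi> i. if i \<in> S then \<Sum>k\<in>S. N i k * (A *v z) $ k else 0)"
  define y where "y = transpose ?B *v u"
  define v where "v = (z - y) /\<^sub>R l"
  have KN: "(\<Sum>k\<in>S. K i k * N k j) = (if i = j then 1 else 0)" if "i \<in> S" "j \<in> S" for i j
    using regularized_imat_inv[OF l K_def that] by (simp add: N_def imat_mult_def imat_one_def)
  have Py: "reg_proj A l S *v z = y"
  proof -
    have "(\<Sum>j\<in>UNIV. (\<Sum>k\<in>S. (\<Sum>h\<in>S. A $ h $ i * N h k) * A $ k $ j) * z $ j)
       = (\<Sum>h\<in>S. A $ h $ i * (\<Sum>k\<in>S. N h k * (\<Sum>j\<in>UNIV. A $ k $ j * z $ j)))" for i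
    proof -
      have "(\<Sum>j\<in>UNIV. (\<Sum>k\<in>S. (\<Sum>h\<in>S. A $ h $ i * N h k) * A $ k $ j) * z $ j)
        = (\<Sum>j\<in>UNIV. \<Sum>k\<in>S. \<Sum>h\<in>S. A $ h $ i * N h k * A $ k $ j * z $ j)"
        by (simp add: sum_distrib_right)
      also have "\<dots> = (\<Sum>k\<in>S. \<Sum>j\<in>UNIV. \<Sum>h\<in>S. A $ h $ i * N h k * A $ k $ j * z $ j)"
        by (rule sum.swap)
      also have "\<dots> = (\<Sum>k\<in>S. \<Sum>h\<in>S. \<Sum>j\<in>UNIV. A $ h $ i * N h k * A $ k $ j * z $ j)"
        by (intro sum.cong refl sum.swap)
      also have "\<dots> = (\<Sum>h\<in>S. \<Sum>k\<in>S. \<Sum>j\<in>UNIV. A $ h $ i * N h k * A $ k $ j * z $ j)"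
        by (rule sum.swap)
      finally show ?thesis by (simp add: sum_distrib_left mult.assoc)
    qed
    moreover have "(\<Sum>h\<in>S. A $ h $ i * (\<Sum>k\<in>S. N h k * (\<Sum>j\<in>UNIV. A $ k $ j * z $ j))) =
       (\<Sum>h\<in>UNIV. ?B $ h $ i * u $ h)" for i
      by (rule sum.mono_neutral_cong_left) (auto simp: mask_rows_def u_def matrix_vector_mult_def)
    moreover have "reg_proj A l S = mat_of_imat (imat_mult S
        (imat_mult S (imat_transpose (row_submatrix A S)) N) (row_submatrix A S))"
      by (simp only: reg_proj_def Let_def K_def N_def)
    ultimately show ?thesis
      by (simp add: mat_of_imat_def
          imat_mult_def imat_transpose_def row_submatrix_def y_def vec_eq_iff
          matrix_vector_mult_def transpose_def cong: sum.cong)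
  qed
  have "u = ?B *v v"
  proof -
    have "(?B *v y) $ i + l * u $ i = (?B *v z) $ i" for i
    proof (cases "i \<in> S")
      case True
      have "(?B *v y) $ i = ((?B ** transpose ?B) *v u) $ i"
        by (simp only: y_def matrix_vector_mul_assoc)
      also have "\<dots> = (\<Sum>h\<in>S. (\<Sum>j\<in>UNIV. A $ i $ j * A $ h $ j) * u $ h)"
        unfolding matrix_vector_mult_def matrix_matrix_mult_def
        using True by (simp, intro sum.mono_neutral_cong_right)
          (auto simp: mask_rows_def transpose_def u_def)
      also have "\<dots> + l * u $ i = (\<Sum>h\<in>S. K i h * u $ h)"
      proof -
        have "(\<Sum>h\<in>S. K i h * u $ h) =
            (\<Sum>h\<in>S. (\<Sum>j\<in>UNIV. A $ i $ j * A $ h $ j) * u $ h + (if h = i then l * u $ i else 0))"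
          using True by (intro sum.cong) (auto simp: K_def imat_add_def imat_mult_def
              imat_transpose_def imat_scale_def imat_one_def row_submatrix_def algebra_simps)
        then show ?thesis using True by (simp add: sum.distrib)
      qed
      also have "\<dots> = (\<Sum>h\<in>S. \<Sum>k\<in>S. K i h * N h k * (A *v z) $ k)"
        by (intro sum.cong) (auto simp: u_def sum_distrib_left mult.assoc)
      also have "\<dots> = (\<Sum>k\<in>S. (\<Sum>h\<in>S. K i h * N h k) * (A *v z) $ k)"
        by (subst sum.swap) (simp add: sum_distrib_right)
      also have "\<dots> = (\<Sum>k\<in>S. if k = i then (A *v z) $ i else 0)"
        by (intro sum.cong) (auto simp: KN True)
      also have "\<dots> = (?B *v z) $ i" using True by (simp add: mask_rows_mult_vec)
      finally show ?thesis .
    qed (simp add: mask_rows_mult_vec u_def)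
    then have "?B *v z = ?B *v y + l *\<^sub>R u" by (simp add: vec_eq_iff)
    then show ?thesis using l
      by (simp add: v_def matrix_vector_mult_scaleR matrix_vector_mult_diff_distrib)
  qed
  then have "y = sub_gram A S *v v" by (simp add: y_def sub_gram_eq matrix_vector_mul_assoc)
  moreover have "z = y + l *\<^sub>R v" using l by (simp add: v_def)
  ultimately show thesis using that[of v] Py by simp
qed

lemma psd_sub_gram: "psd (sub_gram A S)"
  unfolding sub_gram_eq by (rule psd_gram)

text \<open>The two terms on the right are exactly those that bound the quadratic form of the pseudoinverse of
  the mean in the key estimate below.\<close>

lemma reg_proj_quadratic_form:
  assumes "reg_proj A l S *v z = sub_gram A S *v v" "z = sub_gram A S *v v + l *\<^sub>R v"
  shows "z \<bullet> (reg_proj A l S *v z) =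
    (norm (reg_proj A l S *v z))\<^sup>2 + l * (v \<bullet> (sub_gram A S *v v))"
  using assms(1) by (subst assms(2)) (simp add: inner_simps power2_norm_eq_inner)

lemma psd_reg_proj:
  assumes l: "0 < l"
  shows "psd (reg_proj A l S)"
proof -
  let ?P = "reg_proj A l S" and ?H = "sub_gram A S"
  have symH: "transpose ?H = ?H" and H0: "0 \<le> v \<bullet> (?H *v v)" for v
    using psd_sub_gram[of A S] by (auto simp: psd_def)
  have "transpose ?P = ?P"
  proof (rule symmetric_matrixI)
    fix x y
    obtain v where v: "?P *v x = ?H *v v" "x = ?H *v v + l *\<^sub>R v" using reg_proj_resolvent[OF l] .
    obtain w where w: "?P *v y = ?H *v w" "y = ?H *v w + l *\<^sub>R w" using reg_proj_resolvent[OF l] .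
    have "(?H *v v + l *\<^sub>R v) \<bullet> (?H *v w) = (?H *v v) \<bullet> (?H *v w + l *\<^sub>R w)"
      using inner_symmetric_matrix[OF symH, of v w] by (simp add: inner_simps)
    then show "x \<bullet> (?P *v y) = (?P *v x) \<bullet> y"
      by (simp only: v(1) w(1) v(2)[symmetric] w(2)[symmetric])
  qed
  moreover have "0 \<le> z \<bullet> (?P *v z)" for z
  proof -
    obtain v where v: "?P *v z = ?H *v v" "z = ?H *v v + l *\<^sub>R v" using reg_proj_resolvent[OF l] .
    from reg_proj_quadratic_form[OF v] show ?thesis using l H0[of v] by simp
  qed
  ultimately show ?thesis by (simp add: psd_def)
qed

lemma reg_proj_contraction:
  assumes l: "0 < l"
  shows "z \<bullet> (reg_proj A l S *v z) \<le> z \<bullet> z"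
proof -
  obtain v where v: "reg_proj A l S *v z = sub_gram A S *v v" "z = sub_gram A S *v v + l *\<^sub>R v"
    using reg_proj_resolvent[OF l] .
  have "z \<bullet> z - z \<bullet> (reg_proj A l S *v z) = z \<bullet> (z - sub_gram A S *v v)"
    by (simp add: v(1) inner_simps)
  also have "z - sub_gram A S *v v = l *\<^sub>R v" using v(2) by (metis add_diff_cancel_left')
  also have "z \<bullet> (l *\<^sub>R v) = l * (v \<bullet> z)" by (simp add: inner_commute)
  also have "v \<bullet> z = v \<bullet> (sub_gram A S *v v) + l * (v \<bullet> v)"
    by (subst v(2)) (simp add: inner_simps)
  also have "0 \<le> l * \<dots>" using l psd_sub_gram[of A S] by (simp add: psd_def)
  finally show ?thesis by simp
qed

section \<open>The key estimate for a fixed sample\<close>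

text \<open>Young's inequality with weight \<open>c\<close>, in a form that also covers \<open>a = 0\<close>, where \<open>y = 0\<close>.\<close>

lemma inner_Young:
  fixes x y :: "'a::real_inner"
  assumes "0 < c" "0 \<le> a" "0 \<le> r" and le: "y \<bullet> y \<le> a * r"
  shows "2 * (x \<bullet> y) \<le> a / c * (x \<bullet> x) + c * r"
proof (rule power2_le_imp_le)
  have "(2 * (x \<bullet> y))\<^sup>2 \<le> 4 * ((x \<bullet> x) * (y \<bullet> y))"
    using Cauchy_Schwarz_ineq[of x y] by (simp add: power_mult_distrib)
  also have "\<dots> \<le> 4 * ((x \<bullet> x) * (a * r))" using le by (simp add: mult_left_mono)
  also have "\<dots> = 4 * ((a / c * (x \<bullet> x)) * (c * r))" using assms(1) by simp
  also have "\<dots> \<le> (a / c * (x \<bullet> x) + c * r)\<^sup>2"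
    using zero_le_power2[of "a / c * (x \<bullet> x) - c * r"] by (simp add: power2_eq_square algebra_simps)
  finally show "(2 * (x \<bullet> y))\<^sup>2 \<le> (a / c * (x \<bullet> x) + c * r)\<^sup>2" .
qed (use assms in simp)

text \<open>This is \<open>P M\<^sup>\<dagger> P \<preceq> (r / c) P\<close> for \<open>P = P\<^bsub>l,S\<^esub>\<close>. Antitonicity of the pseudoinverse would need a
  discussion of ranges; a duality argument does without. Put \<open>y = P z\<close> and \<open>w = M\<^sup>\<dagger> y\<close>. The number
  \<open>q = y \<bullet> w\<close> also equals \<open>w \<bullet> M w\<close>, so it is at least \<open>c w \<bullet> H (H + lbar I)\<^sup>-\<^sup>1 w\<close>. Writing
  \<open>w = H t + lbar t\<close>, that is \<open>c (|H t|\<^sup>2 + lbar t \<bullet> H t)\<close>, while \<open>q = y \<bullet> H t + lbar v \<bullet> H\<^sub>S t\<close> is linear in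
  \<open>t\<close>. Young's inequality absorbs the \<open>t\<close>-terms into half of the total and leaves
  \<open>c q \<le> |y|\<^sup>2 + a lbar v \<bullet> H\<^sub>S v\<close>, to be compared with \<open>z \<bullet> P z = |y|\<^sup>2 + l v \<bullet> H\<^sub>S v\<close>.\<close>

lemma pinv_form_reg_proj_le:
  fixes A :: "real^'n^'m" and l :: real
  defines "H \<equiv> transpose A ** A"
  assumes l: "0 < l" and lbar: "0 < lbar" and c: "0 < c" and a: "0 \<le> a"
    and M: "psd M"
    and dom: "c *\<^sub>R (H ** matrix_inv (H + lbar *\<^sub>R mat 1)) \<preceq> M"
    and le: "sub_gram A S \<preceq> a *\<^sub>R H"
    and r: "1 \<le> r" "a * lbar \<le> r * l"
  shows "(reg_proj A l S *v z) \<bullet> (pinv M *v (reg_proj A l S *v z)) \<le> r / c * (z \<bullet> (reg_proj A l S *v z))"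
proof -
  let ?HS = "sub_gram A S" and ?B = "mask_rows A S"
  define y where "y = reg_proj A l S *v z"
  define w where "w = pinv M *v y"
  define t where "t = matrix_inv (H + lbar *\<^sub>R mat 1) *v w"
  define q where "q = y \<bullet> w"
  obtain v where v: "y = ?HS *v v" "z = ?HS *v v + l *\<^sub>R v"
    using reg_proj_resolvent[OF l] unfolding y_def by metis
  have H: "psd H" unfolding H_def by (rule psd_gram)
  have w: "w = H *v t + lbar *\<^sub>R t"
  proof -
    have "w = ((H + lbar *\<^sub>R mat 1) ** matrix_inv (H + lbar *\<^sub>R mat 1)) *v w"
      by (simp add: psd_plus_scaled_identity_inverse(1)[OF H lbar])
    also have "\<dots> = (H + lbar *\<^sub>R mat 1) *v t"
      by (simp add: t_def matrix_vector_mul_assoc)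
    finally show ?thesis
      by (simp add: matrix_vector_mult_add_rdistrib scaleR_matrix_vector_assoc[symmetric])
  qed
  define h where "h = (H *v t) \<bullet> (H *v t)"
  define g where "g = t \<bullet> (H *v t)"
  define e where "e = v \<bullet> (?HS *v v)"
  have g0: "0 \<le> g" using H by (simp add: g_def psd_def)
  have e0: "0 \<le> e" using psd_sub_gram[of A S] by (simp add: e_def psd_def)
  have "c * (h + lbar * g) \<le> q"
  proof -
    have "c * (w \<bullet> (H *v t)) \<le> w \<bullet> (M *v w)"
    proof -
      have "(H ** matrix_inv (H + lbar *\<^sub>R mat 1)) *v w = H *v t"
        by (simp add: t_def matrix_vector_mul_assoc)
      then have "(M - c *\<^sub>R (H ** matrix_inv (H + lbar *\<^sub>R mat 1))) *v w = M *v w - c *\<^sub>R (H *v t)"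
        by (simp add: matrix_vector_mult_diff_rdistrib scaleR_matrix_vector_assoc[symmetric])
      moreover have "0 \<le> w \<bullet> ((M - c *\<^sub>R (H ** matrix_inv (H + lbar *\<^sub>R mat 1))) *v w)"
        using dom by (simp add: loewner_le_def psd_def)
      ultimately show ?thesis by (simp add: inner_diff_right)
    qed
    also have "w \<bullet> (M *v w) = q"
    proof -
      have sym: "transpose (pinv M) = pinv M" using psd_pinv(2)[OF M] by (simp add: psd_def)
      have "w \<bullet> (M *v w) = y \<bullet> (pinv M *v (M *v (pinv M *v y)))"
        by (simp add: w_def inner_symmetric_matrix[OF sym])
      also have "\<dots> = y \<bullet> ((pinv M ** M ** pinv M) *v y)"
        by (simp add: matrix_vector_mul_assoc matrix_mul_assoc)
      finally show ?thesis using psd_pinv(1)[OF M] by (simp add: q_def w_def)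
    qed
    also have "w \<bullet> (H *v t) = h + lbar * g" by (subst w) (simp add: inner_simps h_def g_def)
    finally show ?thesis .
  qed
  moreover have "2 * q \<le> 1 / c * (y \<bullet> y) + c * h + lbar * (a / c * e + c * g)"
  proof -
    have "q = y \<bullet> (H *v t) + lbar * ((?B *v v) \<bullet> (?B *v t))"
      unfolding q_def w
      using inner_symmetric_matrix[of ?HS t v] psd_sub_gram[of A S]
      by (simp add: inner_simps v(1) psd_def sub_gram_eq inner_gram inner_commute
          matrix_vector_right_distrib matrix_vector_mult_scaleR)
    moreover have "2 * (y \<bullet> (H *v t)) \<le> 1 / c * (y \<bullet> y) + c * h"
      by (rule inner_Young) (use c in \<open>auto simp: h_def\<close>)
    moreover have "2 * ((?B *v v) \<bullet> (?B *v t)) \<le> a / c * e + c * g"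
    proof -
      have "0 \<le> t \<bullet> ((a *\<^sub>R H - ?HS) *v t)" using le by (simp add: loewner_le_def psd_def)
      then have "(?B *v t) \<bullet> (?B *v t) \<le> a * g"
        by (simp add: matrix_vector_mult_diff_rdistrib scaleR_matrix_vector_assoc[symmetric]
            inner_diff_right sub_gram_eq inner_gram g_def)
      from inner_Young[OF c a g0 this, of "?B *v v"] show ?thesis
        by (simp add: e_def sub_gram_eq inner_gram)
    qed
    then have "lbar * (2 * ((?B *v v) \<bullet> (?B *v t))) \<le> lbar * (a / c * e + c * g)"
      using lbar by (simp add: mult_left_mono)
    ultimately show ?thesis by (simp add: algebra_simps)
  qed
  ultimately have "q \<le> 1 / c * (y \<bullet> y) + lbar * (a / c * e)" by (simp add: algebra_simps)
  also have "\<dots> = 1 / c * (y \<bullet> y + a * lbar * e)" by (simp add: algebra_simps)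
  also have "\<dots> \<le> 1 / c * (r * (y \<bullet> y) + r * l * e)"
    using c r e0 mult_right_mono[OF r(1), of "y \<bullet> y"]
    by (intro mult_left_mono add_mono mult_right_mono) auto
  also have "r * (y \<bullet> y) + r * l * e = r * (z \<bullet> y)"
    using reg_proj_quadratic_form[of A l S z v] v
    by (simp add: y_def e_def power2_norm_eq_inner algebra_simps)
  finally show ?thesis by (simp add: q_def w_def y_def)
qed

lemma sub_gram_loewner_le_gram: "sub_gram A S \<preceq> 1 *\<^sub>R (transpose A ** A)"
proof (unfold loewner_le_def psd_def, intro conjI allI)
  have "transpose (sub_gram A S) = sub_gram A S" "transpose (transpose A ** A) = transpose A ** A"
    using psd_sub_gram psd_gram by (auto simp: psd_def)
  then show "transpose (1 *\<^sub>R (transpose A ** A) - sub_gram A S) = 1 *\<^sub>R (transpose A ** A) - sub_gram A S"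
    by (simp add: transpose_def vec_eq_iff)
  show "0 \<le> x \<bullet> ((1 *\<^sub>R (transpose A ** A) - sub_gram A S) *v x)" for x
    using sub_gram_le_gram[of x A S] by (simp add: matrix_vector_mult_diff_rdistrib inner_diff_right)
qed

section \<open>Averaging over the samples\<close>

text \<open>The sample space is finite, so expectations are finite sums.\<close>

lemma inner_pmf_expectation_matrix:
  fixes F :: "'s::finite \<Rightarrow> real^'n^'n"
  shows "x \<bullet> (measure_pmf.expectation D F *v y) = (\<Sum>s\<in>UNIV. pmf D s * (x \<bullet> (F s *v y)))"
proof -
  have "measure_pmf.expectation D F *v y = (\<Sum>s\<in>UNIV. pmf D s *\<^sub>R (F s *v y))"
  proof -
    have "(\<Sum>s\<in>T. pmf D s *\<^sub>R F s) *v y = (\<Sum>s\<in>T. pmf D s *\<^sub>R (F s *v y))" for T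
      by (induction T rule: infinite_finite_induct)
        (simp_all add: matrix_vector_mult_add_rdistrib scaleR_matrix_vector_assoc)
    then show ?thesis by (subst integral_measure_pmf[of UNIV]) auto
  qed
  then show ?thesis by (simp add: inner_sum_right)
qed

lemma symmetric_pmf_expectation:
  fixes F :: "'s::finite \<Rightarrow> real^'n^'n"
  assumes "\<And>s. transpose (F s) = F s"
  shows "transpose (measure_pmf.expectation D F) = measure_pmf.expectation D F"
proof (rule symmetric_matrixI)
  fix x y
  have "x \<bullet> (measure_pmf.expectation D F *v y) = (\<Sum>s\<in>UNIV. pmf D s * (y \<bullet> (F s *v x)))"
    unfolding inner_pmf_expectation_matrix inner_symmetric_matrix[OF assms, where x = x and y = y]
    by (simp only: inner_commute)
  then show "x \<bullet> (measure_pmf.expectation D F *v y) = (measure_pmf.expectation D F *v x) \<bullet> y"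
    by (metis inner_pmf_expectation_matrix inner_commute)
qed

lemma psd_mean_proj:
  assumes "0 < l"
  shows "psd (mean_proj A l D)"
proof -
  have P: "transpose (reg_proj A l S) = reg_proj A l S" "0 \<le> x \<bullet> (reg_proj A l S *v x)" for S x
    using psd_reg_proj[OF assms, of A S] by (auto simp: psd_def)
  have "transpose (mean_proj A l D) = mean_proj A l D"
    unfolding mean_proj_def by (rule symmetric_pmf_expectation) (rule P(1))
  then show ?thesis
    by (auto simp: psd_def mean_proj_def inner_pmf_expectation_matrix P intro!: sum_nonneg)
qed

text \<open>The matrix \<open>Q M Q\<close> is symmetric and idempotent by the Penrose conditions, so it is an orthogonal
  projection.\<close>

lemma whitened_psd_le_identity:
  fixes M :: "real^'n^'n"
  assumes M: "psd M"
  defines "Q \<equiv> psd_sqrt (pinv M)"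
  shows "x \<bullet> ((Q ** M ** Q) *v x) \<le> x \<bullet> x"
proof -
  define R where "R = Q ** M ** Q"
  have Q: "transpose Q = Q" "Q ** Q = pinv M"
    using psd_sqrt_props[OF psd_pinv(2)[OF M]] by (auto simp: Q_def psd_def)
  have "transpose R = R"
    using M by (simp add: R_def matrix_transpose_mul Q psd_def matrix_mul_assoc)
  moreover have "R ** R = R"
  proof -
    have "R ** R = Q ** (M ** (Q ** Q) ** M) ** Q" by (simp add: R_def matrix_mul_assoc)
    then show ?thesis using psd_pinv(1)[OF M] by (simp add: Q R_def)
  qed
  ultimately have eq: "x \<bullet> (R *v x) = (norm (R *v x))\<^sup>2"
    by (metis inner_symmetric_matrix matrix_vector_mul_assoc power2_norm_eq_inner)
  have "x \<bullet> (R *v x) \<le> norm x * norm (R *v x)" by (rule norm_cauchy_schwarz)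
  with eq have "norm (R *v x) \<le> norm x"
    by (cases "norm (R *v x) = 0") (auto simp: power2_eq_square)
  then have "(norm (R *v x))\<^sup>2 \<le> (norm x)\<^sup>2" by (simp add: power_mono)
  with eq show ?thesis by (simp add: R_def power2_norm_eq_inner)
qed

text \<open>As \<open>Q Q = X\<close>, the matrix \<open>(Q P Q)\<^sup>2\<close> is \<open>Q (P X P) Q\<close>, which is the shape of the key estimate.\<close>

lemma normalized_second_moment_form:
  fixes A :: "real^'n^'m" and l :: real and D :: "'m set pmf"
  assumes l: "0 < l"
  defines "N \<equiv> normalized_second_moment A l D" and "X \<equiv> pinv (mean_proj A l D)"
  defines "Q \<equiv> psd_sqrt X"
  shows "transpose N = N"
    and "x \<bullet> (N *v x) = (\<Sum>S\<in>UNIV. pmf D S *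
      ((reg_proj A l S *v (Q *v x)) \<bullet> (X *v (reg_proj A l S *v (Q *v x)))))"
proof -
  have X: "psd X" unfolding X_def by (rule psd_pinv(2)[OF psd_mean_proj[OF l]])
  have Q: "transpose Q = Q" "Q ** Q = X"
    using psd_sqrt_props[OF X] by (auto simp: Q_def psd_def)
  have P: "transpose (reg_proj A l S) = reg_proj A l S" for S
    using psd_reg_proj[OF l] by (auto simp: psd_def)
  have N: "N = measure_pmf.expectation D
      (\<lambda>S. (Q ** reg_proj A l S ** Q) ** (Q ** reg_proj A l S ** Q))"
    by (simp add: N_def normalized_second_moment_def Q_def X_def Let_def)
  have form: "x \<bullet> (((Q ** reg_proj A l S ** Q) ** (Q ** reg_proj A l S ** Q)) *v y) =
     (reg_proj A l S *v (Q *v x)) \<bullet> (X *v (reg_proj A l S *v (Q *v y)))" for x y S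
    by (simp add: Q(2)[symmetric] inner_symmetric_matrix[OF Q(1)] inner_symmetric_matrix[OF P]
        flip: matrix_vector_mul_assoc)
  show "transpose N = N"
    unfolding N by (rule symmetric_pmf_expectation) (simp add: matrix_transpose_mul Q(1) P matrix_mul_assoc)
  show "x \<bullet> (N *v x) = (\<Sum>S\<in>UNIV. pmf D S *
      ((reg_proj A l S *v (Q *v x)) \<bullet> (X *v (reg_proj A l S *v (Q *v x)))))"
    by (simp add: N inner_pmf_expectation_matrix form)
qed

text \<open>Samples with \<open>H\<^sub>S \<preceq> a H\<close> contribute according to the key estimate with factor \<open>r / c\<close>. The others
  obey it with \<open>a = 1\<close>, that is with factor \<open>lbar / (c l)\<close>; for them \<open>z \<bullet> P z \<le> z \<bullet> z\<close>, and with \<open>z = Q x\<close> the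
  right-hand side is \<open>x \<bullet> M\<^sup>\<dagger> x\<close>, at most the spectral norm of \<open>M\<^sup>\<dagger>\<close> times \<open>x \<bullet> x\<close>.\<close>

lemma lambda_max_normalized_second_moment_le:
  fixes A :: "real^'n^'m" and l :: real and D :: "'m set pmf"
  defines "H \<equiv> transpose A ** A" and "M \<equiv> mean_proj A l D"
  assumes l: "0 < l" and lbar: "l \<le> lbar" and c: "0 < c" and a: "0 \<le> a"
    and dom: "c *\<^sub>R (H ** matrix_inv (H + lbar *\<^sub>R mat 1)) \<preceq> M"
    and r: "1 \<le> r" "a * lbar \<le> r * l"
  shows "lambda_max (normalized_second_moment A l D)
    \<le> (r + lbar / l * (measure_pmf.prob D {S. \<not> sub_gram A S \<preceq> a *\<^sub>R H} * spectral_norm (pinv M))) / c"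
proof (rule lambda_max_le)
  show "transpose (normalized_second_moment A l D) = normalized_second_moment A l D"
    by (rule normalized_second_moment_form(1)[OF l])
  fix x
  let ?P = "\<lambda>S. reg_proj A l S" and ?Bad = "{S. \<not> sub_gram A S \<preceq> a *\<^sub>R H}"
  define X where "X = pinv M"
  define Q where "Q = psd_sqrt X"
  define z where "z = Q *v x"
  define f where "f = (\<lambda>S. (?P S *v z) \<bullet> (X *v (?P S *v z)))"
  define g where "g = (\<lambda>S. z \<bullet> (?P S *v z))"
  have M: "psd M" unfolding M_def by (rule psd_mean_proj[OF l])
  have g0: "0 \<le> g S" for S using psd_reg_proj[OF l, of A S] by (simp add: g_def psd_def)
  have Q: "transpose Q = Q" "Q ** Q = X"
    using psd_sqrt_props[OF psd_pinv(2)[OF M]] by (auto simp: Q_def X_def psd_def)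
  have good: "f S \<le> r / c * g S" if "S \<notin> ?Bad" for S
    unfolding f_def g_def X_def
    by (rule pinv_form_reg_proj_le) (use l lbar c a r M dom that in \<open>auto simp: H_def\<close>)
  have always: "f S \<le> lbar / l / c * g S" for S
    unfolding f_def g_def X_def
    by (rule pinv_form_reg_proj_le[where a = 1 and lbar = lbar, OF _ _ _ _ _ _ sub_gram_loewner_le_gram])
      (use l lbar c M dom in \<open>auto simp: H_def\<close>)
  have "x \<bullet> (normalized_second_moment A l D *v x) = (\<Sum>S\<in>UNIV. pmf D S * f S)"
    using normalized_second_moment_form(2)[OF l, of x A D]
    by (simp add: f_def z_def Q_def X_def M_def)
  also have "\<dots> \<le> (\<Sum>S\<in>UNIV. r / c * (pmf D S * g S) +
      lbar / l / c * (z \<bullet> z) * (if S \<in> ?Bad then pmf D S else 0))"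
  proof (rule sum_mono)
    fix S
    show "pmf D S * f S \<le> r / c * (pmf D S * g S) +
      lbar / l / c * (z \<bullet> z) * (if S \<in> ?Bad then pmf D S else 0)"
    proof (cases "S \<in> ?Bad")
      case True
      have "f S \<le> lbar / l / c * (z \<bullet> z)"
        using always[of S] mult_left_mono[OF reg_proj_contraction[OF l, of z A S], of "lbar / l / c"]
          l lbar c by (simp add: g_def)
      moreover have "0 \<le> r / c * g S" using r c g0[of S] by simp
      ultimately have "f S \<le> r / c * g S + lbar / l / c * (z \<bullet> z)" by linarith
      from mult_left_mono[OF this pmf_nonneg[of D S]] show ?thesis using True
        by (simp add: algebra_simps)
    next
      case False
      from mult_left_mono[OF good[OF False] pmf_nonneg[of D S]] show ?thesis using False
        by (simp add: algebra_simps)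
    qed
  qed
  also have "\<dots> = r / c * (\<Sum>S\<in>UNIV. pmf D S * g S)
      + lbar / l / c * (z \<bullet> z) * (\<Sum>S\<in>UNIV. if S \<in> ?Bad then pmf D S else 0)"
    by (simp only: sum.distrib sum_distrib_left)
  also have "(\<Sum>S\<in>UNIV. if S \<in> ?Bad then pmf D S else 0) = measure_pmf.prob D ?Bad"
    by (simp add: measure_measure_pmf_finite sum.If_cases)
  also have "(\<Sum>S\<in>UNIV. pmf D S * g S) = x \<bullet> ((Q ** M ** Q) *v x)"
  proof -
    have "x \<bullet> ((Q ** M ** Q) *v x) = z \<bullet> (M *v z)"
      by (simp add: z_def inner_symmetric_matrix[OF Q(1)] flip: matrix_vector_mul_assoc)
    then show ?thesis by (simp add: M_def mean_proj_def inner_pmf_expectation_matrix g_def)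
  qed
  also have "r / c * \<dots> + lbar / l / c * (z \<bullet> z) * measure_pmf.prob D ?Bad
    \<le> r / c * (x \<bullet> x) + lbar / l / c * (spectral_norm X * (x \<bullet> x)) * measure_pmf.prob D ?Bad"
  proof (intro add_mono mult_left_mono mult_right_mono)
    show "x \<bullet> ((Q ** M ** Q) *v x) \<le> x \<bullet> x"
      using whitened_psd_le_identity[OF M] by (simp add: Q_def X_def)
    have "z \<bullet> z = x \<bullet> (X *v x)"
      by (simp add: z_def Q(2)[symmetric] inner_symmetric_matrix[OF Q(1)] flip: matrix_vector_mul_assoc)
    also have "\<dots> \<le> norm x * norm (X *v x)" by (rule norm_cauchy_schwarz)
    also have "\<dots> \<le> norm x * (spectral_norm X * norm x)"
      unfolding spectral_norm_def
      by (intro mult_left_mono onorm matrix_vector_mul_bounded_linear) simp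
    finally show "z \<bullet> z \<le> spectral_norm X * (x \<bullet> x)"
      by (simp add: dot_square_norm power2_eq_square mult_ac)
  qed (use l lbar c r in auto)
  finally show "x \<bullet> (normalized_second_moment A l D *v x)
    \<le> (r + lbar / l * (measure_pmf.prob D ?Bad * spectral_norm (pinv M))) / c * (x \<bullet> x)"
    by (simp add: X_def add_divide_distrib algebra_simps)
qed

section \<open>The bounds on the normalized second moment\<close>

theorem theorem3p8:
  fixes A :: "real^'n^'m" and l lbar c :: real and D :: "'m set pmf"
  assumes "0 < l" and "l \<le> lbar"
    and "0 < c" and "c \<le> 1"
    and "c *\<^sub>R ((transpose A ** A) ** matrix_inv (transpose A ** A + lbar *\<^sub>R mat 1))
           \<preceq> mean_proj A l D"
  shows "lambda_max (normalized_second_moment A l D) \<le> 2 * lbar / (c * l) \<and>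
    (\<forall>\<alpha> \<delta>. 0 \<le> \<alpha> \<and> \<alpha> \<le> 1 \<and>
        0 \<le> \<delta> \<and> \<delta> \<le> \<alpha> / spectral_norm (pinv (mean_proj A l D)) \<and>
        measure_pmf.prob D {S. sub_gram A S \<preceq> \<alpha> *\<^sub>R (transpose A ** A)} \<ge> 1 - \<delta>
      \<longrightarrow> lambda_max (normalized_second_moment A l D) \<le> 2 / c * (1 + \<alpha> * (lbar / l)))"
proof (intro conjI allI impI; (elim conjE)?)
  have ratio: "1 \<le> lbar / l" using assms by simp
  \<comment> \<open>With \<open>a = 1\<close> no sample is exceptional, and the error term vanishes.\<close>
  have "lambda_max (normalized_second_moment A l D) \<le> lbar / l / c"
    using lambda_max_normalized_second_moment_le[OF assms(1-3) _ assms(5), of 1 "lbar / l"]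
      sub_gram_loewner_le_gram[of A] assms(1,2) by simp
  also have "\<dots> \<le> 2 * lbar / (c * l)" using assms(1-3) by (simp add: field_simps)
  finally show "lambda_max (normalized_second_moment A l D) \<le> 2 * lbar / (c * l)" .
  fix \<alpha> \<delta> :: real
  let ?X = "pinv (mean_proj A l D)"
  let ?Good = "{S. sub_gram A S \<preceq> \<alpha> *\<^sub>R (transpose A ** A)}"
  assume \<alpha>: "0 \<le> \<alpha>" "\<alpha> \<le> 1" and \<delta>: "0 \<le> \<delta>" "\<delta> \<le> \<alpha> / spectral_norm ?X"
    and prob: "measure_pmf.prob D ?Good \<ge> 1 - \<delta>"
  have bad: "measure_pmf.prob D {S. \<not> sub_gram A S \<preceq> \<alpha> *\<^sub>R (transpose A ** A)} \<le> \<delta>"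
    using prob measure_pmf.prob_compl[of ?Good D] by (simp add: Collect_neg_eq Compl_eq_Diff_UNIV)
  have X0: "0 \<le> spectral_norm ?X"
    unfolding spectral_norm_def by (intro onorm_pos_le matrix_vector_mul_bounded_linear)
  have "measure_pmf.prob D {S. \<not> sub_gram A S \<preceq> \<alpha> *\<^sub>R (transpose A ** A)} * spectral_norm ?X
    \<le> \<delta> * spectral_norm ?X"
    using bad X0 by (rule mult_right_mono)
  \<comment> \<open>If the spectral norm is zero, so is the left-hand side, whatever the value of \<open>\<delta>\<close>.\<close>
  also have "\<dots> \<le> \<alpha>"
    using \<delta>(2) \<alpha>(1) X0 by (cases "spectral_norm ?X = 0") (auto simp: field_simps)
  finally have "lbar / l * (measure_pmf.prob D {S. \<not> sub_gram A S \<preceq> \<alpha> *\<^sub>R (transpose A ** A)}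
      * spectral_norm ?X) \<le> lbar / l * \<alpha>"
    using ratio by (intro mult_left_mono) auto
  moreover have "lambda_max (normalized_second_moment A l D) \<le>
    (1 + \<alpha> * (lbar / l) + lbar / l * (measure_pmf.prob D
        {S. \<not> sub_gram A S \<preceq> \<alpha> *\<^sub>R (transpose A ** A)} * spectral_norm ?X)) / c"
    by (rule lambda_max_normalized_second_moment_le)
      (use assms \<alpha> in \<open>auto simp: field_simps\<close>)
  ultimately have "lambda_max (normalized_second_moment A l D) \<le> (1 + \<alpha> * (lbar / l) + lbar / l * \<alpha>) / c"
    using assms(3) by (smt (verit) divide_right_mono)
  also have "\<dots> \<le> 2 / c * (1 + \<alpha> * (lbar / l))"
    using assms(3) by (simp add: divide_simps)
  finally show "lambda_max (normalized_second_moment A l D) \<le> 2 / c * (1 + \<alpha> * (lbar / l))" .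
qed

end
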